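(* Let $\mathcal H$ be a complex Hilbert space, let $T\in\mathcal B(\mathcal H)$ and let $m\ge1$ be an integer. Then $T$ is similar to an $m$-partial isometry if and only if there exists $S\in\mathcal B(\mathcal H)$ such that $T\,\Delta^m_{S,T}(I)=0$ and $T^*\sim_+S$.
   Context: $\mathcal B(\mathcal H)$ denotes the bounded linear operators on $\mathcal H$ and $I$ the identity. For $V\in\mathcal B(\mathcal H)$ and an integer $m\ge1$, let $\beta_m(V)=\sum_{k=0}^m(-1)^{m-k}\binom mk V^{*k}V^k$; $V$ is an $m$-partial isometry if $V\beta_m(V)=0$. Two operators $A,B\in\mathcal B(\mathcal H)$ are similar if $A=X^{-1}BX$ for some invertible $X\in\mathcal B(\mathcal H)$. $A\sim_+B$ means similarity via a positive intertwiner: $A=PBP^{-1}$ for some positive invertible $P\in\mathcal B(\mathcal H)$. For $S,T\in\mathcal B(\mathcal H)$, $\Delta^m_{S,T}(I)=\sum_{k=0}^m(-1)^k\binom mk S^{m-k}T^{m-k}$. *)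

theory Defs
  imports "HOL-Analysis.Analysis"
begin

text \<open>The complex inner product is linear in its first argument.  The last two axioms tie the complex
  structure to the library's real one; together with the \<open>real_inner\<close> axioms they make the norm
  the one induced by the complex inner product, so that \<open>complete_space\<close> is completeness for it.\<close>

class complex_hilbert_space = real_inner + complete_space +
  fixes scaleC :: "complex \<Rightarrow> 'a \<Rightarrow> 'a" (infixr "*\<^sub>C" 75)
    and cinner :: "'a \<Rightarrow> 'a \<Rightarrow> complex"
  assumes scaleC_add_right: "c *\<^sub>C (x + y) = c *\<^sub>C x + c *\<^sub>C y"
    and scaleC_add_left: "(c + d) *\<^sub>C x = c *\<^sub>C x + d *\<^sub>C x"
    and scaleC_scaleC: "c *\<^sub>C d *\<^sub>C x = (c * d) *\<^sub>C x"
    and scaleC_one: "1 *\<^sub>C x = x"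
    and cinner_add_left: "cinner (x + y) z = cinner x z + cinner y z"
    and cinner_scaleC_left: "cinner (c *\<^sub>C x) y = c * cinner x y"
    and cinner_commute: "cinner x y = cnj (cinner y x)"
    and scaleR_scaleC: "r *\<^sub>R x = complex_of_real r *\<^sub>C x"
    and inner_eq_Re_cinner: "inner x y = Re (cinner x y)"

text \<open>Bounded operators are represented as functions, so the product of operators is \<open>\<circ>\<close>,
  powers are \<open>^^\<close>, the identity is \<open>id\<close>, and sums are pointwise.\<close>

definition bounded_op :: "('a::complex_hilbert_space \<Rightarrow> 'a) \<Rightarrow> bool" where
  "bounded_op A \<longleftrightarrow> bounded_linear A \<and> (\<forall>c x. A (c *\<^sub>C x) = c *\<^sub>C A x)"

text \<open>For a bounded operator the adjoint exists by the Riesz representation theorem.\<close>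

definition adj :: "('a::complex_hilbert_space \<Rightarrow> 'a) \<Rightarrow> 'a \<Rightarrow> 'a" where
  "adj A = (THE B. \<forall>x y. cinner (A x) y = cinner x (B y))"

definition invertible_op :: "('a::complex_hilbert_space \<Rightarrow> 'a) \<Rightarrow> bool" where
  "invertible_op X \<longleftrightarrow> bounded_op X \<and> (\<exists>Y. bounded_op Y \<and> X \<circ> Y = id \<and> Y \<circ> X = id)"

definition positive_op :: "('a::complex_hilbert_space \<Rightarrow> 'a) \<Rightarrow> bool" where
  "positive_op P \<longleftrightarrow> bounded_op P \<and> (\<forall>x. cinner (P x) x \<in> \<real> \<and> 0 \<le> Re (cinner (P x) x))"

text \<open>Below, \<open>inv X\<close> is the inverse function, which for an invertible operator is its inverse in
  the algebra of bounded operators.\<close>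

definition similar_op :: "('a::complex_hilbert_space \<Rightarrow> 'a) \<Rightarrow> ('a \<Rightarrow> 'a) \<Rightarrow> bool" where
  "similar_op A B \<longleftrightarrow> (\<exists>X. invertible_op X \<and> A = inv X \<circ> B \<circ> X)"

definition pos_similar_op :: "('a::complex_hilbert_space \<Rightarrow> 'a) \<Rightarrow> ('a \<Rightarrow> 'a) \<Rightarrow> bool"
    (infix "\<sim>\<^sub>+" 50) where
  "A \<sim>\<^sub>+ B \<longleftrightarrow> (\<exists>P. positive_op P \<and> invertible_op P \<and> A = P \<circ> B \<circ> inv P)"

definition beta :: "nat \<Rightarrow> ('a::complex_hilbert_space \<Rightarrow> 'a) \<Rightarrow> 'a \<Rightarrow> 'a" where
  "beta m V = (\<lambda>x. \<Sum>k=0..m. ((-1) ^ (m - k) * real (m choose k)) *\<^sub>R ((adj V ^^ k) \<circ> (V ^^ k)) x)"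

definition m_partial_isometry :: "nat \<Rightarrow> ('a::complex_hilbert_space \<Rightarrow> 'a) \<Rightarrow> bool" where
  "m_partial_isometry m V \<longleftrightarrow> bounded_op V \<and> V \<circ> beta m V = (\<lambda>x. 0)"

text \<open>\<open>Delta_I m S T\<close> is the operator $\Delta^m_{S,T}(I)$.\<close>

definition Delta_I ::
    "nat \<Rightarrow> ('a::complex_hilbert_space \<Rightarrow> 'a) \<Rightarrow> ('a \<Rightarrow> 'a) \<Rightarrow> 'a \<Rightarrow> 'a" where
  "Delta_I m S T =
    (\<lambda>x. \<Sum>k=0..m. ((-1) ^ k * real (m choose k)) *\<^sub>R ((S ^^ (m - k)) \<circ> (T ^^ (m - k))) x)"

end

theory Submission
  imports Defs
begin

text \<open>If \<open>T = X\<inverse> V X\<close> and \<open>S = X\<inverse> V\<^sup>* X\<close>, then \<open>S\<^sup>k T\<^sup>k = X\<inverse> V\<^sup>*\<^sup>k V\<^sup>k X\<close>, so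
  \<open>T \<Delta>\<^sup>m\<^bsub>S,T\<^esub>(I) = X\<inverse> V \<beta>\<^sub>m(V) X\<close> and the two vanishing conditions agree; moreover
  \<open>T\<^sup>* = P S P\<inverse>\<close> for the positive invertible operator \<open>P = X\<^sup>* X\<close>. Conversely, a positive
  invertible \<open>P\<close> determines a suitable \<open>X\<close>, its square root.\<close>

\<comment> \<open>With this instance \<open>'a \<Rightarrow>\<^sub>L 'a\<close> is complete, as the
  fixed point argument for square roots requires.\<close>
subclass (in complex_hilbert_space) banach ..

section \<open>Complex scalars and the complex inner product\<close>

text \<open>Since \<open>Re (- \<i> * z) = Im z\<close>, the real inner product determines the
  complex one. Identities between complex-linear maps can thus be proved for \<open>inner\<close>
  and then lifted to \<open>cinner\<close>.\<close>

lemma cinner_eq_inner: "cinner x y = Complex (inner x y) (inner ((- \<i>) *\<^sub>C x) y)"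
  by (simp add: complex_eq_iff inner_eq_Re_cinner cinner_scaleC_left)

lemma cinner_scaleC_right: "cinner x (c *\<^sub>C y) = cnj c * cinner x y"
  by (metis cinner_commute cinner_scaleC_left complex_cnj_mult)

lemma cinner_add_right: "cinner x (y + z) = cinner x y + cinner x z"
  by (metis cinner_add_left cinner_commute complex_cnj_add)

lemma norm_scaleC: "norm (c *\<^sub>C x) = cmod c * norm x"
proof -
  have "Im (cinner x x) = 0"
    by (metis cinner_commute complex_cnj cnj.simps(2) equal_neg_zero)
  then have "inner (c *\<^sub>C x) (c *\<^sub>C x) = (cmod c)\<^sup>2 * inner x x"
    unfolding inner_eq_Re_cinner cinner_scaleC_left cinner_scaleC_right cmod_power2
    by (simp add: algebra_simps power2_eq_square)
  then show ?thesis
    unfolding norm_eq_sqrt_inner by (simp add: real_sqrt_mult)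
qed

lemma bounded_linear_scaleC: "bounded_linear ((*\<^sub>C) c)"
proof (rule bounded_linear_intro)
  show "c *\<^sub>C (r *\<^sub>R x) = r *\<^sub>R (c *\<^sub>C x)" for r x
    by (simp add: scaleR_scaleC scaleC_scaleC mult.commute)
  show "norm (c *\<^sub>C x) \<le> norm x * cmod c" for x
    by (simp add: norm_scaleC mult.commute)
qed (rule scaleC_add_right)

lemma scaleC_zero: "c *\<^sub>C 0 = 0"
  by (rule linear_0[OF bounded_linear.linear[OF bounded_linear_scaleC]])

lemma scaleC_diff: "c *\<^sub>C (x - y) = c *\<^sub>C x - c *\<^sub>C y"
  by (rule linear_diff[OF bounded_linear.linear[OF bounded_linear_scaleC]])

lemma scaleC_scaleR: "c *\<^sub>C (r *\<^sub>R x) = r *\<^sub>R (c *\<^sub>C x)"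
  by (rule linear_scale[OF bounded_linear.linear[OF bounded_linear_scaleC]])

lemma cinner_ext_right: "y = z" if "\<And>x. cinner x y = cinner x z"
proof -
  have "inner x y = inner x z" for x
    using that by (simp add: inner_eq_Re_cinner)
  then show ?thesis
    by (metis inner_commute vector_eq_rdot)
qed

lemma bounded_opD:
  assumes "bounded_op A"
  shows "bounded_linear A" "A (c *\<^sub>C x) = c *\<^sub>C A x"
  using assms by (auto simp: bounded_op_def)

lemma bounded_op_comp: "bounded_op A \<Longrightarrow> bounded_op B \<Longrightarrow> bounded_op (A \<circ> B)"
  by (auto simp: bounded_op_def o_def intro: bounded_linear_compose)

section \<open>Riesz representation and adjoints\<close>

text \<open>The functional is represented by the minimiser of \<open>\<lambda>x. (norm x)\<^sup>2 - 2 * f x\<close>; minimising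
  sequences are Cauchy by the parallelogram law.\<close>

lemma riesz_representation:
  fixes f :: "'a::{real_inner, complete_space} \<Rightarrow> real"
  assumes "bounded_linear f"
  obtains u where "\<And>x. f x = inner x u"
proof -
  interpret f: bounded_linear f by fact
  define J where "J x = inner x x - 2 * f x" for x
  obtain K where K: "\<And>x. norm (f x) \<le> norm x * K"
    using f.bounded by blast
  \<comment> \<open>Completing the square: \<open>J x\<close> is at least
    \<open>(norm x - K)\<^sup>2 - K\<^sup>2\<close>.\<close>
  have lower: "- (K\<^sup>2) \<le> J x" for x
  proof -
    have "f x \<le> norm x * K"
      using K[of x] by simp
    moreover have "0 \<le> (norm x - K)\<^sup>2"
      by simp
    ultimately show ?thesis
      by (simp add: J_def power2_norm_eq_inner[symmetric] power2_eq_square algebra_simps)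
  qed
  define I where "I = Inf (range J)"
  have bdd: "bdd_below (range J)"
    using lower by (auto simp: bdd_below_def)
  have I_le: "I \<le> J x" for x
    unfolding I_def by (rule cInf_lower) (use bdd in auto)
  have "\<exists>x. J x < I + 1 / real (Suc n)" for n
    using cInf_lessD[of "range J" "I + 1 / real (Suc n)"] by (auto simp: I_def)
  then obtain X where X: "\<And>n. J (X n) < I + 1 / real (Suc n)"
    by metis
  \<comment> \<open>The linear terms cancel against those at the midpoint, where \<open>J\<close> is
    at least \<open>I\<close>.\<close>
  have parallelogram: "(norm (x - y))\<^sup>2 \<le> 2 * (J x - I) + 2 * (J y - I)" for x y
  proof -
    have "(norm (x - y))\<^sup>2 = 2 * J x + 2 * J y - 4 * J ((1/2) *\<^sub>R (x + y))"
      unfolding J_def power2_norm_eq_inner f.scaleR f.add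
      by (simp add: inner_simps inner_commute field_simps)
    then show ?thesis
      using I_le[of "(1/2) *\<^sub>R (x + y)"] by simp
  qed
  have J_lim: "(\<lambda>n. J (X n)) \<longlonglongrightarrow> I"
  proof (rule tendsto_sandwich[where f = "\<lambda>_. I"])
    show "(\<lambda>n. I + 1 / real (Suc n)) \<longlonglongrightarrow> I"
      using tendsto_add[OF tendsto_const LIMSEQ_inverse_real_of_nat, of I]
      by (simp add: inverse_eq_divide)
  qed (use I_le X in \<open>auto intro!: always_eventually less_imp_le\<close>)
  have "Cauchy X"
  proof (rule metric_CauchyI)
    fix e :: real assume "0 < e"
    then have "\<forall>\<^sub>F n in sequentially. J (X n) < I + e\<^sup>2 / 4"
      using order_tendstoD(2)[OF J_lim] by simp
    then obtain M where M: "\<And>n. n \<ge> M \<Longrightarrow> J (X n) < I + e\<^sup>2 / 4"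
      by (auto simp: eventually_sequentially)
    have "dist (X k) (X n) < e" if "k \<ge> M" "n \<ge> M" for k n
    proof -
      have "(norm (X k - X n))\<^sup>2 < e\<^sup>2"
        using parallelogram[of "X k" "X n"] M[OF that(1)] M[OF that(2)] by simp
      then show ?thesis
        using \<open>0 < e\<close> by (simp add: dist_norm power2_less_imp_less)
    qed
    then show "\<exists>M. \<forall>k\<ge>M. \<forall>n\<ge>M. dist (X k) (X n) < e"
      by blast
  qed
  then obtain u where u: "X \<longlonglongrightarrow> u"
    using Cauchy_convergent convergent_def by blast
  have "(\<lambda>n. J (X n)) \<longlonglongrightarrow> J u"
    unfolding J_def by (intro tendsto_intros u f.tendsto)
  then have Ju: "J u = I"
    using J_lim LIMSEQ_unique by blast
  have "f x = inner x u" for x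
  proof (rule ccontr)
    define d where "d = f x - inner x u"
    \<comment> \<open>Moving from \<open>u\<close> by \<open>t *\<^sub>R x\<close> changes
      \<open>J\<close> by \<open>t\<^sup>2 * inner x x - 2 * t * d\<close>. The added 1 keeps the
      denominator positive, and the change is still strictly negative.\<close>
    define t where "t = d / (1 + inner x x)"
    assume "f x \<noteq> inner x u"
    then have d: "d \<noteq> 0" by (simp add: d_def)
    have pos: "0 < 1 + inner x x"
      by (simp add: add_pos_nonneg)
    have "J (u + t *\<^sub>R x) = J u - 2 * (t * d) + t\<^sup>2 * inner x x"
      by (simp add: J_def d_def f.add f.scaleR inner_simps inner_commute power2_eq_square algebra_simps)
    moreover have "t * d = t\<^sup>2 + t\<^sup>2 * inner x x"
    proof -
      have "d = t * (1 + inner x x)"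
        using pos by (simp add: t_def)
      then show ?thesis
        by (simp add: power2_eq_square algebra_simps)
    qed
    moreover have "0 < t\<^sup>2" "0 \<le> t\<^sup>2 * inner x x"
      using d pos by (auto simp: t_def)
    ultimately have "J (u + t *\<^sub>R x) < J u"
      by linarith
    then show False
      using I_le Ju by (simp add: not_less[symmetric])
  qed
  then show ?thesis
    using that by blast
qed

text \<open>The adjoint equation fixes each value of \<open>B\<close>, so the definite description
  picks out \<open>B\<close>. Later adjoints are computed by exhibiting a candidate.\<close>

lemma adj_equality:
  assumes "\<And>x y. cinner (A x) y = cinner x (B y)"
  shows "adj A = B"
  unfolding adj_def
proof (rule the_equality)
  show "C = B" if "\<forall>x y. cinner (A x) y = cinner x (C y)" for C
  proof
    show "C y = B y" for y
      by (rule cinner_ext_right) (metis that assms)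
  qed
qed (use assms in blast)

text \<open>Riesz representation of \<open>\<lambda>x. inner (A x) y\<close> yields a real adjoint.
  As \<open>A\<close> commutes with multiplication by \<open>- \<i>\<close>, the same map is the
  complex adjoint.\<close>

lemma cinner_adj:
  assumes "bounded_op A"
  shows "cinner (A x) y = cinner x (adj A y)"
proof -
  have "\<exists>u. \<forall>x. inner (A x) y = inner x u" for y
  proof -
    have "bounded_linear (\<lambda>x. inner (A x) y)"
      using bounded_opD(1)[OF assms] bounded_linear_compose bounded_linear_inner_left by blast
    then show ?thesis
      using riesz_representation by metis
  qed
  then obtain B where B: "\<And>x y. inner (A x) y = inner x (B y)"
    by metis
  have *: "cinner (A x) y = cinner x (B y)" for x y
    by (simp only: cinner_eq_inner bounded_opD(2)[OF assms, symmetric] B)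
  show ?thesis
    using * adj_equality[OF *] by simp
qed

lemma bounded_op_adj:
  assumes "bounded_op A"
  shows "bounded_op (adj A)"
proof -
  obtain K where K: "\<And>x. norm (A x) \<le> norm x * K"
    using bounded_linear.bounded[OF bounded_opD(1)[OF assms]] by blast
  have add: "adj A (x + y) = adj A x + adj A y" for x y
    by (rule cinner_ext_right) (simp add: cinner_add_right flip: cinner_adj[OF assms])
  have scaleC: "adj A (c *\<^sub>C x) = c *\<^sub>C adj A x" for c x
    by (rule cinner_ext_right) (simp add: cinner_scaleC_right flip: cinner_adj[OF assms])
  have "norm (adj A y) \<le> norm y * K" for y
  proof (cases "adj A y = 0")
    case True
    have "0 \<le> norm y * K"
      using norm_ge_zero[of "A y"] K[of y] by linarith
    with True show ?thesis by simp
  next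
    case False
    \<comment> \<open>The adjoint relation at \<open>adj A y\<close> leaves one factor
      \<open>norm (adj A y)\<close> to cancel after Cauchy-Schwarz.\<close>
    have "norm (adj A y) * norm (adj A y) = inner (A (adj A y)) y"
      by (simp add: cinner_adj[OF assms] inner_eq_Re_cinner norm_eq_sqrt_inner
          flip: power2_eq_square power2_norm_eq_inner)
         (simp add: inner_eq_Re_cinner[symmetric])
    also have "\<dots> \<le> norm (A (adj A y)) * norm y"
      by (rule norm_cauchy_schwarz)
    also have "\<dots> \<le> norm (adj A y) * K * norm y"
      by (intro mult_right_mono K) simp
    finally show ?thesis
      using False by (simp add: mult.assoc mult.commute)
  qed
  then have "bounded_linear (adj A)"
    by (intro bounded_linear_intro[of _ K] add) (auto simp: scaleR_scaleC scaleC)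
  then show ?thesis
    by (simp add: bounded_op_def scaleC)
qed

lemma adj_comp:
  assumes "bounded_op A" "bounded_op B"
  shows "adj (A \<circ> B) = adj B \<circ> adj A"
  by (rule adj_equality) (simp add: cinner_adj assms)

lemma adj_id: "adj id = id"
  by (rule adj_equality) simp

section \<open>Invertible operators and their adjoints\<close>

lemma invertible_opI:
  assumes "bounded_op X" "bounded_op Y" "X \<circ> Y = id" "Y \<circ> X = id"
  shows "invertible_op X" "inv X = Y"
  using assms by (auto simp: invertible_op_def intro!: inv_unique_comp)

lemma invertible_opD:
  assumes "invertible_op X"
  shows "bounded_op X" "bounded_op (inv X)" "X (inv X x) = x" "inv X (X x) = x"
proof -
  obtain Y where Y: "bounded_op X" "bounded_op Y" "X \<circ> Y = id" "Y \<circ> X = id"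
    using assms by (auto simp: invertible_op_def)
  moreover have "inv X = Y"
    using Y by (rule invertible_opI)
  ultimately show "bounded_op X" "bounded_op (inv X)" "X (inv X x) = x" "inv X (X x) = x"
    by (simp_all add: pointfree_idE)
qed

lemma invertible_op_adj:
  assumes "invertible_op X"
  shows "invertible_op (adj X)" "inv (adj X) = adj (inv X)"
proof -
  note X = invertible_opD[OF assms]
  have "inv X \<circ> X = id" "X \<circ> inv X = id"
    by (simp_all add: fun_eq_iff X)
  then have "adj X \<circ> adj (inv X) = id" "adj (inv X) \<circ> adj X = id"
    by (simp_all add: X adj_id flip: adj_comp)
  then show "invertible_op (adj X)" "inv (adj X) = adj (inv X)"
    by (rule invertible_opI[OF bounded_op_adj bounded_op_adj, OF X(1,2)])+
qed

section \<open>Positive operators and their square roots\<close>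

text \<open>Polarisation: once the real diagonal terms are removed, the imaginary part of the
  quadratic form at \<open>x + \<i> *\<^sub>C y\<close> is
  \<open>Re (cinner (P y) x) - Re (cinner (P x) y)\<close>, and it vanishes.\<close>

lemma positive_op_symmetric:
  assumes "positive_op P"
  shows "inner (P x) y = inner x (P y)"
proof -
  have P: "bounded_op P" and real: "\<And>x. Im (cinner (P x) x) = 0"
    using assms by (auto simp: positive_op_def complex_is_Real_iff)
  have add: "P (x + y) = P x + P y" for x y
    using bounded_opD(1)[OF P] by (simp add: bounded_linear.axioms(1) linear_add)
  have "Re (cinner (P x) y) = Re (cinner (P y) x)"
    using real[of "x + \<i> *\<^sub>C y"] real[of x] real[of y]
    by (simp add: add bounded_opD(2)[OF P] cinner_add_left cinner_add_right
        cinner_scaleC_left cinner_scaleC_right)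
  then show ?thesis
    by (metis inner_eq_Re_cinner inner_commute)
qed

text \<open>With \<open>X = I - Y\<close>, the equation \<open>X\<^sup>2 = I - A\<close> is the fixed point equation
  \<open>Y = (A + Y\<^sup>2) / 2\<close>, whose right-hand side is a contraction of the ball of radius \<open>norm A < 1\<close>.\<close>

lemma sqrt_near_identity:
  fixes A :: "'a::complex_hilbert_space \<Rightarrow>\<^sub>L 'a"
  assumes "norm A < 1"
    and A_scaleC: "\<And>c x. A (c *\<^sub>C x) = c *\<^sub>C A x"
    and A_symmetric: "\<And>x y. inner (A x) y = inner x (A y)"
  obtains X where "bounded_op X" "\<And>x y. inner (X x) y = inner x (X y)" "\<And>x. X (X x) = x - A x"
proof -
  define r where "r = norm A"
  \<comment> \<open>A \<open>blinfun\<close> records only real linearity. Complex linearity and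
    symmetry are closed conditions, so they are built into the domain of the iteration and pass to
    the fixed point.\<close>
  define C :: "('a \<Rightarrow>\<^sub>L 'a) set" where
    "C = cball 0 r \<inter> {Y. \<forall>c x. blinfun_apply Y (c *\<^sub>C x) = c *\<^sub>C Y x}
      \<inter> {Y. \<forall>x y. inner (blinfun_apply Y x) y = inner x (blinfun_apply Y y)}"
  define F :: "('a \<Rightarrow>\<^sub>L 'a) \<Rightarrow> 'a \<Rightarrow>\<^sub>L 'a" where "F Y = (1/2) *\<^sub>R (A + (Y o\<^sub>L Y))" for Y
  have r: "0 \<le> r" "r < 1"
    using assms(1) by (auto simp: r_def)
  have "closed C"
    unfolding C_def
    by (intro closed_Int closed_cball closed_Collect_all closed_Collect_eq continuous_intros
        bounded_linear.continuous_on[OF bounded_linear_scaleC])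
  then have "complete C"
    by (simp add: complete_eq_closed)
  moreover have "C \<noteq> {}"
  proof -
    have "0 \<in> C"
      using r by (simp add: C_def scaleC_zero)
    then show ?thesis by blast
  qed
  moreover have "F ` C \<subseteq> C"
  proof clarify
    fix Y assume Y: "Y \<in> C"
    have "norm (Y o\<^sub>L Y) \<le> norm Y * norm Y"
      by (rule norm_blinfun_compose)
    \<comment> \<open>Here \<open>r < 1\<close> bounds one factor by 1, so that the average of
      \<open>A\<close> and \<open>Y o\<^sub>L Y\<close> stays in the ball.\<close>
    also have "\<dots> \<le> r * 1"
      using Y r by (intro mult_mono) (auto simp: C_def)
    finally have "norm (A + (Y o\<^sub>L Y)) \<le> 2 * r"
      using norm_triangle_ineq[of A "Y o\<^sub>L Y"] by (simp add: r_def)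
    then have "norm (F Y) \<le> r"
      by (simp add: F_def)
    moreover have "F Y (c *\<^sub>C x) = c *\<^sub>C F Y x" for c x
      using Y A_scaleC
      by (simp add: C_def F_def blinfun.bilinear_simps scaleC_add_right scaleC_scaleR)
    moreover have "inner (F Y x) y = inner x (F Y y)" for x y
      using Y A_symmetric by (simp add: C_def F_def blinfun.bilinear_simps inner_simps)
    ultimately show "F Y \<in> C"
      by (simp add: C_def)
  qed
  moreover have "dist (F Y) (F Z) \<le> r * dist Y Z" if "Y \<in> C" "Z \<in> C" for Y Z
  proof -
    \<comment> \<open>This splitting of the difference of squares does not need \<open>Y\<close> and
      \<open>Z\<close> to commute.\<close>
    have "F Y - F Z = (1/2) *\<^sub>R ((Y o\<^sub>L (Y - Z)) + ((Y - Z) o\<^sub>L Z))"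
      by (rule blinfun_eqI) (simp add: F_def blinfun.bilinear_simps algebra_simps)
    then have "dist (F Y) (F Z) = (1/2) * norm ((Y o\<^sub>L (Y - Z)) + ((Y - Z) o\<^sub>L Z))"
      by (simp add: dist_norm)
    also have "\<dots> \<le> (1/2) * (norm Y * norm (Y - Z) + norm (Y - Z) * norm Z)"
      by (intro mult_left_mono norm_triangle_le add_mono norm_blinfun_compose) simp
    also have "\<dots> \<le> (1/2) * (r * norm (Y - Z) + norm (Y - Z) * r)"
      using that by (intro mult_left_mono add_mono mult_right_mono) (auto simp: C_def)
    finally show ?thesis
      by (simp add: dist_norm mult.commute)
  qed
  ultimately have "\<exists>!Y. Y \<in> C \<and> F Y = Y"
    by (intro Banach_fix[OF _ _ r]) auto
  then obtain Y where Y: "Y \<in> C" "F Y = Y"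
    by blast
  have sq: "Y (Y x) = 2 *\<^sub>R Y x - A x" for x
  proof -
    have "Y x = (1/2) *\<^sub>R (A x + Y (Y x))"
      by (subst Y(2)[symmetric]) (simp add: F_def blinfun.bilinear_simps)
    then have "2 *\<^sub>R Y x = 2 *\<^sub>R ((1/2) *\<^sub>R (A x + Y (Y x)))"
      by (rule arg_cong)
    then show ?thesis by simp
  qed
  show ?thesis
  proof
    have "bounded_linear (\<lambda>x. x - Y x)"
      by (intro bounded_linear_sub bounded_linear_ident blinfun.bounded_linear_right)
    moreover have "c *\<^sub>C x - Y (c *\<^sub>C x) = c *\<^sub>C (x - Y x)" for c x
      using Y(1) by (simp add: C_def scaleC_diff)
    ultimately show "bounded_op (\<lambda>x. x - Y x)"
      by (simp add: bounded_op_def)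
    show "inner (x - Y x) y = inner x (y - Y y)" for x y
      using Y(1) by (simp add: C_def inner_simps)
    show "(x - Y x) - Y (x - Y x) = x - A x" for x
      by (simp add: blinfun.bilinear_simps sq scaleR_2)
  qed
qed

text \<open>For \<open>K\<close> bounding \<open>P\<close>, positivity and invertibility make
  \<open>A = I - P / K\<close> a strict contraction. A root of \<open>I - A = P / K\<close> is then
  scaled by \<open>sqrt K\<close>.\<close>

lemma sqrt_positive_invertible_op:
  assumes "positive_op P" "invertible_op P"
  obtains X where "invertible_op X" "adj X = X" "X \<circ> X = P"
proof -
  note P = invertible_opD[OF assms(2)]
  interpret P: bounded_linear P
    using bounded_opD(1)[OF P(1)] .
  obtain K where K: "0 < K" "\<And>x. norm (P x) \<le> norm x * K"
    using P.pos_bounded by blast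
  obtain L where L: "0 < L" "\<And>x. norm (inv P x) \<le> norm x * L"
    using bounded_linear.pos_bounded[OF bounded_opD(1)[OF P(2)]] by blast
  have pos: "0 \<le> inner (P x) x" for x
    using assms(1) by (simp add: positive_op_def inner_eq_Re_cinner)
  have sym: "inner (P x) y = inner x (P y)" for x y
    using assms(1) by (rule positive_op_symmetric)
  \<comment> \<open>This is the operator inequality between \<open>P\<^sup>2\<close> and
    \<open>K P\<close>. It follows from positivity at \<open>x - (1/K) *\<^sub>R P x\<close>, with
    the cubic term bounded through \<open>K\<close>.\<close>
  have le: "inner (P x) (P x) / K \<le> inner (P x) x" for x
  proof -
    define y where "y = P x"
    have "inner (P y) y \<le> norm y * K * norm y"
      by (rule order_trans[OF norm_cauchy_schwarz]) (intro mult_right_mono K(2); simp)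
    then have "inner (P y) y \<le> K * inner y y"
      by (simp add: power2_norm_eq_inner[symmetric] power2_eq_square mult_ac)
    then have "inner (P y) y / K\<^sup>2 \<le> inner y y / K"
      using K(1) by (simp add: field_simps power2_eq_square)
    moreover have "0 \<le> inner (P (x - (1/K) *\<^sub>R y)) (x - (1/K) *\<^sub>R y)"
      by (rule pos)
    moreover have "inner (P (x - (1/K) *\<^sub>R y)) (x - (1/K) *\<^sub>R y)
        = inner y x - 2 * inner y y / K + inner (P y) y / K\<^sup>2"
      using sym[of y x]
      by (simp add: P.diff P.scaleR inner_simps y_def[symmetric] power2_eq_square diff_divide_distrib)
    ultimately show ?thesis
      by (simp add: y_def)
  qed
  \<comment> \<open>Expanding the square and using \<open>le\<close> leaves at most
    \<open>(norm x)\<^sup>2 - (norm (P x))\<^sup>2 / K\<^sup>2\<close>; the bound \<open>L\<close>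
    of the inverse gives \<open>norm (P x) \<ge> norm x / L\<close>.\<close>
  define q where "q = 1 - 1 / (K * L)\<^sup>2"
  have contract: "(norm (x - (1/K) *\<^sub>R P x))\<^sup>2 \<le> q * (norm x)\<^sup>2" for x
  proof -
    have "norm x \<le> norm (P x) * L"
      using L(2)[of "P x"] by (simp add: P(4))
    then have "(norm x)\<^sup>2 \<le> (norm (P x) * L)\<^sup>2"
      by (intro power_mono) simp_all
    then have "(norm x)\<^sup>2 / (K * L)\<^sup>2 \<le> (norm (P x))\<^sup>2 / K\<^sup>2"
      using K(1) L(1) by (simp add: field_simps power_mult_distrib)
    moreover have "(norm (x - (1/K) *\<^sub>R P x))\<^sup>2
        = (norm x)\<^sup>2 - 2 * inner (P x) x / K + (norm (P x))\<^sup>2 / K\<^sup>2"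
      unfolding power2_norm_eq_inner
      by (simp add: inner_simps inner_commute power2_eq_square)
    moreover have "(norm (P x))\<^sup>2 / K\<^sup>2 \<le> inner (P x) x / K"
      using divide_right_mono[OF le[of x], of K] K(1)
      unfolding power2_norm_eq_inner by (simp add: power2_eq_square)
    ultimately show ?thesis
      by (simp add: q_def algebra_simps)
  qed
  define A where "A = Blinfun (\<lambda>x. x - (1/K) *\<^sub>R P x)"
  have A: "blinfun_apply A = (\<lambda>x. x - (1/K) *\<^sub>R P x)"
    unfolding A_def
    by (intro bounded_linear_Blinfun_apply bounded_linear_sub bounded_linear_ident
        bounded_linear_compose[OF bounded_linear_scaleR_right] P.bounded_linear_axioms)
  \<comment> \<open>On the zero space \<open>K * L\<close> may be less than 1 and \<open>q\<close>
    negative; the maximum keeps the argument of \<open>sqrt\<close> nonnegative.\<close>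
  have "norm A \<le> sqrt (max q 0)"
  proof (rule norm_blinfun_bound)
    fix x
    have "(norm (A x))\<^sup>2 \<le> max q 0 * (norm x)\<^sup>2"
      unfolding A by (rule order_trans[OF contract]) (intro mult_right_mono; simp)
    then have "(norm (A x))\<^sup>2 \<le> (sqrt (max q 0) * norm x)\<^sup>2"
      by (simp add: power_mult_distrib)
    then show "norm (A x) \<le> sqrt (max q 0) * norm x"
      by (rule power2_le_imp_le) simp
  qed simp
  also have "\<dots> < 1"
    using K(1) L(1) by (simp add: q_def)
  finally have normA: "norm A < 1" .
  have "A (c *\<^sub>C x) = c *\<^sub>C A x" for c x
    by (simp add: A bounded_opD(2)[OF P(1)] scaleC_diff scaleC_scaleR)
  moreover have "inner (A x) y = inner x (A y)" for x y
    by (simp add: A inner_simps sym)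
  ultimately obtain R where R: "bounded_op R" "\<And>x y. inner (R x) y = inner x (R y)"
      "\<And>x. R (R x) = x - A x"
    using sqrt_near_identity[OF normA] by metis
  interpret R: bounded_linear R
    using bounded_opD(1)[OF R(1)] .
  define X where "X x = sqrt K *\<^sub>R R x" for x
  have X: "bounded_op X"
    unfolding bounded_op_def X_def
    by (auto intro!: bounded_linear_compose[OF bounded_linear_scaleR_right] R.bounded_linear_axioms
        simp: bounded_opD(2)[OF R(1)] scaleC_scaleR)
  have XX: "X (X x) = P x" for x
    using K(1) by (simp add: X_def R.scaleR R(3) A)
  \<comment> \<open>Being a root of \<open>P\<close>, \<open>X\<close> commutes with
    \<open>P\<close> and hence with \<open>inv P\<close>; this makes \<open>X \<circ> inv P\<close>
    a two-sided inverse of \<open>X\<close>.\<close>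
  have XP: "X (P x) = P (X x)" for x
    by (simp flip: XX)
  have "X (inv P x) = inv P (X x)" for x
    by (metis P(3) P(4) XP)
  then have "invertible_op X"
    by (intro invertible_opI(1)[of X "X \<circ> inv P"] X bounded_op_comp P) (auto simp: fun_eq_iff XX P)
  moreover have "adj X = X"
  proof (rule adj_equality)
    have *: "inner (X x) y = inner x (X y)" for x y
      by (simp add: X_def R(2))
    show "cinner (X x) y = cinner x (X y)" for x y
      by (simp only: cinner_eq_inner bounded_opD(2)[OF X, symmetric] *)
  qed
  moreover have "X \<circ> X = P"
    by (auto simp: XX)
  ultimately show ?thesis
    using that by blast
qed

section \<open>Conjugation of the defining operator sums\<close>

lemma funpow_conjugate:
  assumes "X \<circ> Y = id" "Y \<circ> X = id"
  shows "(Y \<circ> A \<circ> X) ^^ k = Y \<circ> A ^^ k \<circ> X"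
proof (induction k)
  case 0
  then show ?case by (simp add: assms)
next
  case (Suc k)
  have "X (Y z) = z" for z
    using assms(1) by (simp add: fun_eq_iff)
  with Suc show ?case
    by (auto simp: fun_eq_iff)
qed

text \<open>Conjugation respects products, powers and real combinations. Stated as an identity, this
  serves both directions of the equivalence.\<close>

lemma Delta_I_conjugate:
  assumes "invertible_op X" "T = inv X \<circ> V \<circ> X" "S = inv X \<circ> adj V \<circ> X"
  shows "T \<circ> Delta_I m S T = inv X \<circ> (V \<circ> beta m V) \<circ> X"
proof -
  note X = invertible_opD[OF assms(1)]
  have id: "X \<circ> inv X = id" "inv X \<circ> X = id"
    using X by auto
  interpret Y: bounded_linear "inv X"
    using bounded_opD(1)[OF X(2)] .
  have "Delta_I m S T x = inv X (beta m V (X x))" for x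
  proof -
    have "Delta_I m S T x = (\<Sum>k=0..m. ((-1) ^ k * real (m choose k)) *\<^sub>R
        inv X ((adj V ^^ (m - k)) ((V ^^ (m - k)) (X x))))"
      unfolding Delta_I_def assms(2,3) funpow_conjugate[OF id] by (simp add: X)
    \<comment> \<open>The two sums are indexed in opposite order: in \<open>Delta_I\<close> the
      power is \<open>m - k\<close>, in \<open>beta\<close> it is \<open>k\<close>.\<close>
    also have "\<dots> = (\<Sum>k=0..m. ((-1) ^ (m - k) * real (m choose k)) *\<^sub>R
        inv X ((adj V ^^ k) ((V ^^ k) (X x))))"
      by (rule sum.reindex_bij_witness[of _ "\<lambda>k. m - k" "\<lambda>k. m - k"])
         (auto simp: binomial_symmetric[symmetric])
    also have "\<dots> = inv X (beta m V (X x))"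
      by (simp add: beta_def Y.sum Y.scaleR)
    finally show ?thesis .
  qed
  then show ?thesis
    by (simp add: assms(2) fun_eq_iff X)
qed

lemma conjugate_eq_zero_iff:
  assumes "invertible_op X"
  shows "inv X \<circ> B \<circ> X = (\<lambda>x. 0) \<longleftrightarrow> B = (\<lambda>x. 0)"
proof -
  note X = invertible_opD[OF assms]
  have "X 0 = 0"
    using bounded_opD(1)[OF X(1)] by (simp add: bounded_linear.linear linear_0)
  then show ?thesis
    by (simp add: fun_eq_iff) (metis X(3,4))
qed

section \<open>Similarity to an m-partial isometry\<close>

theorem theorem5p6:
  fixes T :: "'a::complex_hilbert_space \<Rightarrow> 'a" and m :: nat
  assumes "bounded_op T" and "m \<ge> 1"
  shows "(\<exists>V. m_partial_isometry m V \<and> similar_op T V) \<longleftrightarrow>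
    (\<exists>S. bounded_op S \<and> T \<circ> Delta_I m S T = (\<lambda>x. 0) \<and> adj T \<sim>\<^sub>+ S)"
proof
  assume "\<exists>V. m_partial_isometry m V \<and> similar_op T V"
  then obtain V X where V: "bounded_op V" "V \<circ> beta m V = (\<lambda>x. 0)"
    and X: "invertible_op X" and T: "T = inv X \<circ> V \<circ> X"
    by (auto simp: m_partial_isometry_def similar_op_def)
  note XD = invertible_opD[OF X]
  define S where "S = inv X \<circ> adj V \<circ> X"
  define P where "P = adj X \<circ> X"
  have bounded: "bounded_op (adj X)" "bounded_op (adj (inv X))" "bounded_op (adj V)"
    by (simp_all add: bounded_op_adj XD V)
  have inverse: "adj X (adj (inv X) x) = x" "adj (inv X) (adj X x) = x" for x
    using invertible_opD(3,4)[OF invertible_op_adj(1)[OF X]]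
    by (simp_all add: invertible_op_adj(2)[OF X])
  have P: "invertible_op P" "inv P = inv X \<circ> adj (inv X)"
    by (rule invertible_opI[of P "inv X \<circ> adj (inv X)"];
        auto simp: P_def fun_eq_iff XD inverse intro!: bounded_op_comp bounded)+
  \<comment> \<open>By the adjoint relation the quadratic form of \<open>P\<close> at
    \<open>x\<close> is the conjugate of the squared norm of \<open>X x\<close>, hence real and
    nonnegative.\<close>
  have "cinner (P x) x = cnj (cinner (X x) (X x))" for x
    by (metis P_def cinner_adj XD(1) cinner_commute comp_apply)
  moreover have "cinner y y = of_real (inner y y)" for y :: 'a
    by (metis cinner_commute inner_eq_Re_cinner Reals_cnj_iff of_real_Re)
  ultimately have "positive_op P"
    using P(1) by (simp add: positive_op_def invertible_op_def)
  moreover have "adj T = adj X \<circ> adj V \<circ> adj (inv X)"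
    by (simp add: T adj_comp XD V bounded_op_comp o_assoc)
  then have "adj T = P \<circ> S \<circ> inv P"
    unfolding P(2) by (simp add: P_def S_def fun_eq_iff XD)
  ultimately have "adj T \<sim>\<^sub>+ S"
    using P(1) by (auto simp: pos_similar_op_def)
  moreover have "bounded_op S"
    by (simp add: S_def bounded_op_comp XD bounded)
  moreover have "T \<circ> Delta_I m S T = (\<lambda>x. 0)"
    using V(2) by (simp only: Delta_I_conjugate[OF X T S_def] conjugate_eq_zero_iff[OF X])
  ultimately show "\<exists>S. bounded_op S \<and> T \<circ> Delta_I m S T = (\<lambda>x. 0) \<and> adj T \<sim>\<^sub>+ S"
    by blast
next
  assume "\<exists>S. bounded_op S \<and> T \<circ> Delta_I m S T = (\<lambda>x. 0) \<and> adj T \<sim>\<^sub>+ S"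
  then obtain S P where S: "T \<circ> Delta_I m S T = (\<lambda>x. 0)"
    and P: "positive_op P" "invertible_op P" and adjT: "adj T = P \<circ> S \<circ> inv P"
    by (auto simp: pos_similar_op_def)
  obtain X where X: "invertible_op X" "adj X = X" "X \<circ> X = P"
    using sqrt_positive_invertible_op[OF P] .
  note XD = invertible_opD[OF X(1)]
  define V where "V = X \<circ> T \<circ> inv X"
  have V: "bounded_op V"
    by (simp add: V_def bounded_op_comp XD assms(1))
  have T: "T = inv X \<circ> V \<circ> X"
    by (simp add: V_def fun_eq_iff XD)
  have adj_inv: "adj (inv X) = inv X"
    using invertible_op_adj(2)[OF X(1)] by (simp add: X(2))
  have "adj V = inv X \<circ> adj T \<circ> X"
    by (simp add: V_def adj_comp XD assms(1) bounded_op_comp X(2) adj_inv o_assoc)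
  moreover have "inv P = inv X \<circ> inv X"
    by (rule invertible_opI(2)) (auto simp: bounded_op_comp XD fun_eq_iff simp flip: X(3))
  \<comment> \<open>Self-adjointness of \<open>X\<close> gives
    \<open>adj V = inv X \<circ> adj T \<circ> X\<close>. Inserting
    \<open>adj T = P \<circ> S \<circ> inv P\<close> with \<open>P = X \<circ> X\<close> reduces
    this to \<open>X \<circ> S \<circ> inv X\<close>, so \<open>S\<close> has the form that
    \<open>Delta_I_conjugate\<close> requires.\<close>
  ultimately have "S = inv X \<circ> adj V \<circ> X"
    by (simp add: adjT fun_eq_iff XD flip: X(3))
  then have "V \<circ> beta m V = (\<lambda>x. 0)"
    using S by (simp only: Delta_I_conjugate[OF X(1) T] conjugate_eq_zero_iff[OF X(1)])
  then have "m_partial_isometry m V"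
    using V by (simp add: m_partial_isometry_def)
  then show "\<exists>V. m_partial_isometry m V \<and> similar_op T V"
    using X(1) T by (auto simp: similar_op_def)
qed

end
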